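(* Let $(P,\leq)$ be a nonempty partially ordered set which satisfies conditions GLB, DC, and DD, and let $K$ be any field. Then there exists a $K$-algebra $A$ for which $(\mathrm{Spec}(A),\subseteq)\cong(P,\leq)$.
   Context: Algebras are associative, not necessarily unital. A prime ideal of a ring $R$ is a proper two-sided ideal $I$ such that for all $x,y\in R$, $xRy\subseteq I$ implies $x\in I$ or $y\in I$; $\mathrm{Spec}(R)$ is the set of prime ideals ordered by inclusion. $\cong$ denotes order-isomorphism. A subset $S$ of a poset is downward directed if it is nonempty and for all $p,q\in S$ there is $r\in S$ with $r\leq p$ and $r\leq q$. For $S\subseteq P$ and $p\in P$, $p=\mathrm{glb}(S)$ means that $S$ has a greatest lower bound in $P$ and it equals $p$. Let $$\mathcal{R}(P)=\{p\in P\mid p\neq\mathrm{glb}(S)\text{ for all downward directed }S\subseteq P\text{ without least element}\}.$$ Conditions (greatest lower bounds taken in $P$): (GLB) every downward directed subset of $P$ has a greatest lower bound in $P$. (DC) for every downward directed $S\subseteq P$ (having a greatest lower bound) and every $p\in\mathcal{R}(P)$ satisfying $p\geq\mathrm{glb}(S)$, we have $p\geq s$ for some $s\in S$. (DD) for every downward directed $S\subseteq P$ such that $\mathrm{glb}(S)\in P$ (i.e. exists), there is a downward directed subset $T$ of $\mathcal{R}(P)$ with $\mathrm{glb}(S)=\mathrm{glb}(T)$. *)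

theory Defs
  imports "HOL-Algebra.Algebra"
begin

section \<open>Conditions on posets\<close>

definition downward_directed :: "('p, 'q) gorder_scheme \<Rightarrow> 'p set \<Rightarrow> bool" where
  "downward_directed P S \<longleftrightarrow>
     S \<subseteq> carrier P \<and> S \<noteq> {} \<and>
     (\<forall>p\<in>S. \<forall>q\<in>S. \<exists>r\<in>S. r \<sqsubseteq>\<^bsub>P\<^esub> p \<and> r \<sqsubseteq>\<^bsub>P\<^esub> q)"

definition irreducibles :: "('p, 'q) gorder_scheme \<Rightarrow> 'p set" where
  "irreducibles P =
     {p \<in> carrier P.
        \<forall>S. downward_directed P S \<and> \<not> (\<exists>s. least P s S) \<longrightarrow> \<not> is_glb P p S}"

definition cond_GLB :: "('p, 'q) gorder_scheme \<Rightarrow> bool" where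
  "cond_GLB P \<longleftrightarrow> (\<forall>S. downward_directed P S \<longrightarrow> (\<exists>g. is_glb P g S))"

definition cond_DC :: "('p, 'q) gorder_scheme \<Rightarrow> bool" where
  "cond_DC P \<longleftrightarrow>
     (\<forall>S g. downward_directed P S \<and> is_glb P g S \<longrightarrow>
        (\<forall>p\<in>irreducibles P. g \<sqsubseteq>\<^bsub>P\<^esub> p \<longrightarrow> (\<exists>s\<in>S. s \<sqsubseteq>\<^bsub>P\<^esub> p)))"

definition cond_DD :: "('p, 'q) gorder_scheme \<Rightarrow> bool" where
  "cond_DD P \<longleftrightarrow>
     (\<forall>S g. downward_directed P S \<and> is_glb P g S \<longrightarrow>
        (\<exists>T. T \<subseteq> irreducibles P \<and> downward_directed P T \<and> is_glb P g T))"

definition order_isomorphic ::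
    "('p, 'q) gorder_scheme \<Rightarrow> ('r, 's) gorder_scheme \<Rightarrow> bool" where
  "order_isomorphic P Q \<longleftrightarrow>
     (\<exists>f. order_emb P Q f \<and> bij_betw f (carrier P) (carrier Q))"

section \<open>Associative algebras and their prime spectra\<close>

text \<open>The library's \<^locale>\<open>algebra\<close> is unital and commutative. Neither is wanted here,
  so the multiplicative axioms are added to \<^locale>\<open>module\<close> directly. The record still
  has a unit field, on which nothing below depends.\<close>

locale assoc_algebra = K?: field K + module K A for K (structure) and A (structure) +
  assumes amult_closed:
      "\<lbrakk>x \<in> carrier A; y \<in> carrier A\<rbrakk> \<Longrightarrow> x \<otimes>\<^bsub>A\<^esub> y \<in> carrier A"
    and amult_assoc:
      "\<lbrakk>x \<in> carrier A; y \<in> carrier A; z \<in> carrier A\<rbrakk> \<Longrightarrow>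
        (x \<otimes>\<^bsub>A\<^esub> y) \<otimes>\<^bsub>A\<^esub> z = x \<otimes>\<^bsub>A\<^esub> (y \<otimes>\<^bsub>A\<^esub> z)"
    and amult_l_distr:
      "\<lbrakk>x \<in> carrier A; y \<in> carrier A; z \<in> carrier A\<rbrakk> \<Longrightarrow>
        (x \<oplus>\<^bsub>A\<^esub> y) \<otimes>\<^bsub>A\<^esub> z = x \<otimes>\<^bsub>A\<^esub> z \<oplus>\<^bsub>A\<^esub> y \<otimes>\<^bsub>A\<^esub> z"
    and amult_r_distr:
      "\<lbrakk>x \<in> carrier A; y \<in> carrier A; z \<in> carrier A\<rbrakk> \<Longrightarrow>
        z \<otimes>\<^bsub>A\<^esub> (x \<oplus>\<^bsub>A\<^esub> y) = z \<otimes>\<^bsub>A\<^esub> x \<oplus>\<^bsub>A\<^esub> z \<otimes>\<^bsub>A\<^esub> y"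
    and amult_smult_l:
      "\<lbrakk>a \<in> carrier K; x \<in> carrier A; y \<in> carrier A\<rbrakk> \<Longrightarrow>
        (a \<odot>\<^bsub>A\<^esub> x) \<otimes>\<^bsub>A\<^esub> y = a \<odot>\<^bsub>A\<^esub> (x \<otimes>\<^bsub>A\<^esub> y)"
    and amult_smult_r:
      "\<lbrakk>a \<in> carrier K; x \<in> carrier A; y \<in> carrier A\<rbrakk> \<Longrightarrow>
        x \<otimes>\<^bsub>A\<^esub> (a \<odot>\<^bsub>A\<^esub> y) = a \<odot>\<^bsub>A\<^esub> (x \<otimes>\<^bsub>A\<^esub> y)"

text \<open>Ideals are ring ideals, not assumed closed under scalars. The library's
  \<^locale>\<open>ideal\<close> and \<^locale>\<open>primeideal\<close> presuppose a unital, respectively commutative, ring.\<close>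

definition two_sided_ideal :: "'a set \<Rightarrow> ('a, 'r) ring_scheme \<Rightarrow> bool" where
  "two_sided_ideal I R \<longleftrightarrow>
     additive_subgroup I R \<and>
     (\<forall>a\<in>I. \<forall>x\<in>carrier R. x \<otimes>\<^bsub>R\<^esub> a \<in> I \<and> a \<otimes>\<^bsub>R\<^esub> x \<in> I)"

definition prime_ideal :: "'a set \<Rightarrow> ('a, 'r) ring_scheme \<Rightarrow> bool" where
  "prime_ideal I R \<longleftrightarrow>
     two_sided_ideal I R \<and> I \<noteq> carrier R \<and>
     (\<forall>x\<in>carrier R. \<forall>y\<in>carrier R.
        (\<forall>r\<in>carrier R. x \<otimes>\<^bsub>R\<^esub> r \<otimes>\<^bsub>R\<^esub> y \<in> I) \<longrightarrow> x \<in> I \<or> y \<in> I)"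

definition Spec :: "('a, 'r) ring_scheme \<Rightarrow> 'a set gorder" where
  "Spec R = \<lparr>carrier = {I. prime_ideal I R}, eq = (=), le = (\<subseteq>)\<rparr>"

text \<open>HOL cannot quantify existentially over types, so an algebra whose existence is asserted
  for a poset with elements in \<open>'p\<close> and a field with elements in \<open>'k\<close> needs a fixed ambient
  type for its elements. The following one is large enough to contain the \<open>'k\<close>-valued functions
  with finite support on any set of at most max(|P|, aleph-0) many monomials, such as pairs of
  paths in a graph with vertices from P and countably many edges between any two vertices.
  The carrier may be any subset of it.\<close>

type_synonym ('k, 'p) elt = "('p \<times> nat) list \<times> ('p \<times> nat) list \<Rightarrow> 'k"

end

theory Submission
  imports Defs "HOL-Library.Sublist"
begin

text \<open>Let \<open>R\<close> be the set of irreducible elements of \<open>P\<close>. By DD and DC, each \<open>p\<close> is determined by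
  the filter \<open>{r \<in> R. p \<le> r}\<close> of \<open>R\<close>, and by GLB and DC every filter of \<open>R\<close> arises in this way. So
  \<open>P\<close> is the set of filters of \<open>R\<close> under reverse inclusion.

  For the algebra take nonempty words over \<open>R \<times> \<nat>\<close> with descending first components; they are the
  paths of a graph with infinitely many edges from each \<open>p\<close> to each \<open>q \<le> p\<close>. For two words \<open>u\<close>, \<open>v\<close>
  with the same end vertex let \<open>u v\<^sup>*\<close> be the partial shift that replaces the prefix \<open>v\<close> of a word by \<open>u\<close>.
  The span of these shifts is closed under composition. As every vertex emits infinitely many edges
  to each vertex below it, a letter that is fresh for a given element isolates one of its monomials,
  so every ideal is spanned by the monomials in it. Hence an ideal is determined by a down-closed
  set of vertices, and it is prime if and only if the complement of this set is a filter.

  The shifts are realised as operators on \<open>K\<close>-valued functions on words, which makes associativity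
  trivial; the matrix entries of the operators then carry the algebra over to the required type.\<close>

section \<open>Ideals of associative algebras\<close>

lemma (in abelian_group) additive_subgroup_iff:
  "additive_subgroup I G \<longleftrightarrow>
     I \<subseteq> carrier G \<and> \<zero> \<in> I \<and> (\<forall>x\<in>I. \<forall>y\<in>I. x \<oplus> y \<in> I) \<and> (\<forall>x\<in>I. \<ominus> x \<in> I)"
proof
  assume "additive_subgroup I G"
  then have "subgroup I (add_monoid G)" by (rule additive_subgroup.a_subgroup)
  from subgroup.subset[OF this] subgroup.one_closed[OF this] subgroup.m_closed[OF this]
    subgroup.m_inv_closed[OF this]
  show "I \<subseteq> carrier G \<and> \<zero> \<in> I \<and> (\<forall>x\<in>I. \<forall>y\<in>I. x \<oplus> y \<in> I) \<and> (\<forall>x\<in>I. \<ominus> x \<in> I)"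
    by (simp add: a_inv_def)
next
  assume "I \<subseteq> carrier G \<and> \<zero> \<in> I \<and> (\<forall>x\<in>I. \<forall>y\<in>I. x \<oplus> y \<in> I) \<and> (\<forall>x\<in>I. \<ominus> x \<in> I)"
  then show "additive_subgroup I G"
    by (intro additive_subgroup.intro group.subgroupI[OF a_group]) (auto simp: a_inv_def)
qed

text \<open>Negation is multiplication by the scalar \<open>\<ominus>\<one>\<close>, so closure
  under scalars supplies the inverses that a subgroup needs.\<close>

lemma (in assoc_algebra) subspace_additive_subgroup:
  assumes "I \<subseteq> carrier A" "\<zero>\<^bsub>A\<^esub> \<in> I"
    and add: "\<And>x y. x \<in> I \<Longrightarrow> y \<in> I \<Longrightarrow> x \<oplus>\<^bsub>A\<^esub> y \<in> I"
    and smult: "\<And>k x. k \<in> carrier K \<Longrightarrow> x \<in> I \<Longrightarrow> k \<odot>\<^bsub>A\<^esub> x \<in> I"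
  shows "additive_subgroup I A"
proof -
  have "\<ominus>\<^bsub>A\<^esub> x \<in> I" if "x \<in> I" for x
  proof -
    have "(\<ominus>\<one>) \<odot>\<^bsub>A\<^esub> x = \<ominus>\<^bsub>A\<^esub> x" using that assms(1) by (subst smult_l_minus) auto
    then show ?thesis using smult[OF _ that, of "\<ominus>\<one>"] by simp
  qed
  then show ?thesis using assms by (simp add: M.additive_subgroup_iff)
qed

lemma (in assoc_algebra) amult_zero:
  assumes "x \<in> carrier A"
  shows "x \<otimes>\<^bsub>A\<^esub> \<zero>\<^bsub>A\<^esub> = \<zero>\<^bsub>A\<^esub>" "\<zero>\<^bsub>A\<^esub> \<otimes>\<^bsub>A\<^esub> x = \<zero>\<^bsub>A\<^esub>"
  using amult_smult_r[of \<zero> x "\<zero>\<^bsub>A\<^esub>"] amult_smult_l[of \<zero> "\<zero>\<^bsub>A\<^esub>" x] assms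
  by (simp_all add: amult_closed)

lemma two_sided_idealD:
  assumes "two_sided_ideal I A"
  shows "I \<subseteq> carrier A" "\<zero>\<^bsub>A\<^esub> \<in> I"
    "\<And>x y. x \<in> I \<Longrightarrow> y \<in> I \<Longrightarrow> x \<oplus>\<^bsub>A\<^esub> y \<in> I"
    "\<And>a x. a \<in> I \<Longrightarrow> x \<in> carrier A \<Longrightarrow> x \<otimes>\<^bsub>A\<^esub> a \<in> I"
    "\<And>a x. a \<in> I \<Longrightarrow> x \<in> carrier A \<Longrightarrow> a \<otimes>\<^bsub>A\<^esub> x \<in> I"
  using assms unfolding two_sided_ideal_def
  by (auto simp: additive_subgroup.a_subset additive_subgroup.zero_closed additive_subgroup.a_closed
      dest: additive_subgroup.a_Hcarr)

text \<open>With the right factor of a primeness test fixed, the left factors that pass form an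
  ideal. For ideals spanned by monomials this lets a monomial stand in for an arbitrary left
  factor.\<close>

lemma (in assoc_algebra) left_quotient_ideal:
  assumes I: "two_sided_ideal I A" and sm: "\<And>k x. k \<in> carrier K \<Longrightarrow> x \<in> I \<Longrightarrow> k \<odot>\<^bsub>A\<^esub> x \<in> I"
    and y: "y \<in> carrier A"
  shows "two_sided_ideal {x \<in> carrier A. \<forall>r\<in>carrier A. x \<otimes>\<^bsub>A\<^esub> r \<otimes>\<^bsub>A\<^esub> y \<in> I} A"
  unfolding two_sided_ideal_def
proof (intro conjI subspace_additive_subgroup ballI)
  note [simp] = amult_closed amult_l_distr amult_r_distr amult_smult_l amult_smult_r amult_zero y
  note D = two_sided_idealD[OF I]
  note [simp] = D(2,3) sm
  let ?J = "{x \<in> carrier A. \<forall>r\<in>carrier A. x \<otimes>\<^bsub>A\<^esub> r \<otimes>\<^bsub>A\<^esub> y \<in> I}"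
  show "?J \<subseteq> carrier A" "\<zero>\<^bsub>A\<^esub> \<in> ?J" by auto
  show "u \<oplus>\<^bsub>A\<^esub> v \<in> ?J" if "u \<in> ?J" "v \<in> ?J" for u v using that by auto
  show "k \<odot>\<^bsub>A\<^esub> u \<in> ?J" if "k \<in> carrier K" "u \<in> ?J" for k u using that by auto
  show "x \<otimes>\<^bsub>A\<^esub> a \<in> ?J" "a \<otimes>\<^bsub>A\<^esub> x \<in> ?J"
    if "a \<in> ?J" "x \<in> carrier A" for a x
  proof -
    have "a \<otimes>\<^bsub>A\<^esub> x \<otimes>\<^bsub>A\<^esub> r \<otimes>\<^bsub>A\<^esub> y = a \<otimes>\<^bsub>A\<^esub> (x \<otimes>\<^bsub>A\<^esub> r) \<otimes>\<^bsub>A\<^esub> y" if "r \<in> carrier A" for r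
      using \<open>a \<in> ?J\<close> \<open>x \<in> carrier A\<close> that by (simp add: amult_assoc)
    then show "a \<otimes>\<^bsub>A\<^esub> x \<in> ?J" using that by simp
    show "x \<otimes>\<^bsub>A\<^esub> a \<in> ?J" using that D(4) by (auto simp: amult_assoc)
  qed
qed

text \<open>The mirror image, which trades the right factor for a monomial.\<close>

lemma (in assoc_algebra) right_quotient_ideal:
  assumes I: "two_sided_ideal I A" and sm: "\<And>k x. k \<in> carrier K \<Longrightarrow> x \<in> I \<Longrightarrow> k \<odot>\<^bsub>A\<^esub> x \<in> I"
    and y: "y \<in> carrier A"
  shows "two_sided_ideal {x \<in> carrier A. \<forall>r\<in>carrier A. y \<otimes>\<^bsub>A\<^esub> r \<otimes>\<^bsub>A\<^esub> x \<in> I} A"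
  unfolding two_sided_ideal_def
proof (intro conjI subspace_additive_subgroup ballI)
  note [simp] = amult_closed amult_l_distr amult_r_distr amult_smult_l amult_smult_r amult_zero y
  note D = two_sided_idealD[OF I]
  note [simp] = D(2,3) sm
  let ?J = "{x \<in> carrier A. \<forall>r\<in>carrier A. y \<otimes>\<^bsub>A\<^esub> r \<otimes>\<^bsub>A\<^esub> x \<in> I}"
  show "?J \<subseteq> carrier A" "\<zero>\<^bsub>A\<^esub> \<in> ?J" by auto
  show "u \<oplus>\<^bsub>A\<^esub> v \<in> ?J" if "u \<in> ?J" "v \<in> ?J" for u v using that by auto
  show "k \<odot>\<^bsub>A\<^esub> u \<in> ?J" if "k \<in> carrier K" "u \<in> ?J" for k u using that by auto
  show "a \<otimes>\<^bsub>A\<^esub> x \<in> ?J" if a: "a \<in> ?J" and x: "x \<in> carrier A" for a x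
    using a x D(5)[of _ x] by (auto simp: amult_assoc[symmetric])
  show "x \<otimes>\<^bsub>A\<^esub> a \<in> ?J" if a: "a \<in> ?J" and x: "x \<in> carrier A" for a x
  proof -
    have "y \<otimes>\<^bsub>A\<^esub> r \<otimes>\<^bsub>A\<^esub> (x \<otimes>\<^bsub>A\<^esub> a) = y \<otimes>\<^bsub>A\<^esub> (r \<otimes>\<^bsub>A\<^esub> x) \<otimes>\<^bsub>A\<^esub> a" if "r \<in> carrier A" for r
      using a x that by (simp add: amult_assoc)
    then show ?thesis using a x by simp
  qed
qed

section \<open>Transport of structure\<close>

text \<open>\<open>\<psi>\<close> picks preimages, so the operations are the intended ones when
  \<open>\<phi>\<close> is injective on the carrier. The transport moves an algebra of operators
  into the type prescribed for the elements.\<close>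

definition transported_algebra ::
    "('b \<Rightarrow> 'c) \<Rightarrow> ('k, 'b, 's) module_scheme \<Rightarrow> ('k, 'c) module" where
  "transported_algebra \<phi> B =
     (let \<psi> = inv_into (carrier B) \<phi> in
      \<lparr>carrier = \<phi> ` carrier B, monoid.mult = \<lambda>x y. \<phi> (\<psi> x \<otimes>\<^bsub>B\<^esub> \<psi> y), one = \<phi> \<one>\<^bsub>B\<^esub>,
       ring.zero = \<phi> \<zero>\<^bsub>B\<^esub>, ring.add = \<lambda>x y. \<phi> (\<psi> x \<oplus>\<^bsub>B\<^esub> \<psi> y), smult = \<lambda>k x. \<phi> (k \<odot>\<^bsub>B\<^esub> \<psi> x)\<rparr>)"

locale algebra_transport = assoc_algebra K B
  for K :: "('k, 'r) ring_scheme" (structure) and B :: "('k, 'b, 's) module_scheme" +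
  fixes \<phi> :: "'b \<Rightarrow> 'c"
  assumes inj: "inj_on \<phi> (carrier B)"
begin

abbreviation A where "A \<equiv> transported_algebra \<phi> B"

lemma transported_simps [simp]:
  "carrier A = \<phi> ` carrier B" "\<zero>\<^bsub>A\<^esub> = \<phi> \<zero>\<^bsub>B\<^esub>"
  "\<lbrakk>x \<in> carrier B; y \<in> carrier B\<rbrakk> \<Longrightarrow> \<phi> x \<otimes>\<^bsub>A\<^esub> \<phi> y = \<phi> (x \<otimes>\<^bsub>B\<^esub> y)"
  "\<lbrakk>x \<in> carrier B; y \<in> carrier B\<rbrakk> \<Longrightarrow> \<phi> x \<oplus>\<^bsub>A\<^esub> \<phi> y = \<phi> (x \<oplus>\<^bsub>B\<^esub> y)"
  "x \<in> carrier B \<Longrightarrow> k \<odot>\<^bsub>A\<^esub> \<phi> x = \<phi> (k \<odot>\<^bsub>B\<^esub> x)"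
  using inj by (simp_all add: transported_algebra_def Let_def)

lemma assoc_algebra_transported: "assoc_algebra K A"
proof -
  note [simp] = amult_closed amult_l_distr amult_r_distr amult_smult_l amult_smult_r amult_assoc
  have "abelian_group A"
  proof (rule abelian_groupI)
    show "\<exists>y\<in>carrier A. y \<oplus>\<^bsub>A\<^esub> x = \<zero>\<^bsub>A\<^esub>" if "x \<in> carrier A" for x
    proof -
      obtain z where z: "z \<in> carrier B" "x = \<phi> z" using \<open>x \<in> carrier A\<close> by auto
      then have "\<phi> (\<ominus>\<^bsub>B\<^esub> z) \<oplus>\<^bsub>A\<^esub> x = \<zero>\<^bsub>A\<^esub>" by (simp add: M.l_neg)
      with z show ?thesis by auto
    qed
  qed (auto simp: M.a_assoc intro!: arg_cong[of _ _ \<phi>] intro: M.a_comm)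
  then have "module K A"
    by (intro moduleI K.is_cring) (auto simp: smult_l_distr smult_r_distr smult_assoc1)
  then show ?thesis
    by (intro assoc_algebra.intro assoc_algebra_axioms.intro K.field_axioms) auto
qed

lemma mem_image_iff: "I \<subseteq> carrier B \<Longrightarrow> x \<in> carrier B \<Longrightarrow> \<phi> x \<in> \<phi> ` I \<longleftrightarrow> x \<in> I"
  using inj by (auto simp: inj_on_def)

lemma two_sided_ideal_transported:
  assumes "I \<subseteq> carrier B"
  shows "two_sided_ideal (\<phi> ` I) A \<longleftrightarrow> two_sided_ideal I B"
proof -
  interpret A: assoc_algebra K A by (rule assoc_algebra_transported)
  have minus: "\<ominus>\<^bsub>A\<^esub> \<phi> x = \<phi> (\<ominus>\<^bsub>B\<^esub> x)" if "x \<in> carrier B" for x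
    using that by (intro A.M.minus_equality) (auto simp: M.l_neg)
  have "additive_subgroup (\<phi> ` I) A \<longleftrightarrow> additive_subgroup I B"
    unfolding A.M.additive_subgroup_iff M.additive_subgroup_iff ball_simps
  proof (intro conj_cong ball_cong refl)
    show "\<phi> ` I \<subseteq> carrier A \<longleftrightarrow> I \<subseteq> carrier B" using assms by auto
    show "\<zero>\<^bsub>A\<^esub> \<in> \<phi> ` I \<longleftrightarrow> \<zero>\<^bsub>B\<^esub> \<in> I" using assms by (simp add: mem_image_iff)
  next
    fix x y assume "x \<in> I" "y \<in> I"
    then have "x \<in> carrier B" "y \<in> carrier B" using assms by auto
    then show "\<phi> x \<oplus>\<^bsub>A\<^esub> \<phi> y \<in> \<phi> ` I \<longleftrightarrow> x \<oplus>\<^bsub>B\<^esub> y \<in> I"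
      using assms by (simp add: mem_image_iff)
  next
    fix x assume "x \<in> I"
    then have "x \<in> carrier B" using assms by auto
    then show "\<ominus>\<^bsub>A\<^esub> \<phi> x \<in> \<phi> ` I \<longleftrightarrow> \<ominus>\<^bsub>B\<^esub> x \<in> I"
      using assms by (simp add: mem_image_iff minus)
  qed
  moreover have "(\<forall>a\<in>\<phi> ` I. \<forall>x\<in>carrier A. x \<otimes>\<^bsub>A\<^esub> a \<in> \<phi> ` I \<and> a \<otimes>\<^bsub>A\<^esub> x \<in> \<phi> ` I) \<longleftrightarrow>
      (\<forall>a\<in>I. \<forall>x\<in>carrier B. x \<otimes>\<^bsub>B\<^esub> a \<in> I \<and> a \<otimes>\<^bsub>B\<^esub> x \<in> I)"
    unfolding transported_simps ball_simps
  proof (intro ball_cong refl)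
    fix a x assume "a \<in> I" "x \<in> carrier B"
    with assms have "a \<in> carrier B" "x \<in> carrier B" by auto
    with assms show "(\<phi> x \<otimes>\<^bsub>A\<^esub> \<phi> a \<in> \<phi> ` I \<and> \<phi> a \<otimes>\<^bsub>A\<^esub> \<phi> x \<in> \<phi> ` I) \<longleftrightarrow>
        (x \<otimes>\<^bsub>B\<^esub> a \<in> I \<and> a \<otimes>\<^bsub>B\<^esub> x \<in> I)"
      by (simp add: mem_image_iff amult_closed)
  qed
  ultimately show ?thesis by (simp only: two_sided_ideal_def)
qed

lemma prime_ideal_transported:
  assumes "I \<subseteq> carrier B"
  shows "prime_ideal (\<phi> ` I) A \<longleftrightarrow> prime_ideal I B"
proof -
  have "\<phi> ` I = carrier A \<longleftrightarrow> I = carrier B"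
    using assms inj by (metis inj_on_image_eq_iff order_refl transported_simps(1))
  moreover have "\<phi> x \<otimes>\<^bsub>A\<^esub> \<phi> r \<otimes>\<^bsub>A\<^esub> \<phi> y \<in> \<phi> ` I \<longleftrightarrow> x \<otimes>\<^bsub>B\<^esub> r \<otimes>\<^bsub>B\<^esub> y \<in> I"
    if "x \<in> carrier B" "r \<in> carrier B" "y \<in> carrier B" for x r y
    using assms that by (simp add: mem_image_iff amult_closed)
  ultimately show ?thesis
    using assms by (simp add: prime_ideal_def two_sided_ideal_transported mem_image_iff)
qed

text \<open>An ideal of \<open>A\<close> lies inside the image of \<open>\<phi>\<close>, hence is
  itself the image of a subset of \<open>carrier B\<close>; primeness then transfers in both
  directions.\<close>

lemma carrier_Spec_transported:
  "carrier (Spec A) = (`) \<phi> ` carrier (Spec B)"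
proof
  show "carrier (Spec A) \<subseteq> (`) \<phi> ` carrier (Spec B)"
  proof
    fix J assume "J \<in> carrier (Spec A)"
    then have J: "prime_ideal J A" by (simp add: Spec_def)
    then have "J \<subseteq> \<phi> ` carrier B"
      using two_sided_idealD(1)[of J A] by (simp add: prime_ideal_def)
    then obtain I where I: "I \<subseteq> carrier B" "J = \<phi> ` I" by (auto simp: subset_image_iff)
    then show "J \<in> (`) \<phi> ` carrier (Spec B)" using J by (auto simp: prime_ideal_transported Spec_def)
  qed
next
  show "(`) \<phi> ` carrier (Spec B) \<subseteq> carrier (Spec A)"
  proof
    fix J assume "J \<in> (`) \<phi> ` carrier (Spec B)"
    then obtain I where I: "prime_ideal I B" "J = \<phi> ` I" by (auto simp: Spec_def)
    then have "I \<subseteq> carrier B" using two_sided_idealD(1)[of I B] by (simp add: prime_ideal_def)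
    then show "J \<in> carrier (Spec A)" using I by (simp add: Spec_def prime_ideal_transported)
  qed
qed

end

section \<open>Filters of irreducible elements\<close>

definition poset_filter :: "'p set \<Rightarrow> ('p \<Rightarrow> 'p \<Rightarrow> bool) \<Rightarrow> 'p set \<Rightarrow> bool" where
  "poset_filter Q leq F \<longleftrightarrow>
     F \<subseteq> Q \<and> F \<noteq> {} \<and> (\<forall>p\<in>F. \<forall>q\<in>Q. leq p q \<longrightarrow> q \<in> F) \<and>
     (\<forall>p\<in>F. \<forall>q\<in>F. \<exists>r\<in>F. leq r p \<and> leq r q)"

definition irreducibles_above :: "('p, 'q) gorder_scheme \<Rightarrow> 'p \<Rightarrow> 'p set" where
  "irreducibles_above P p = {r \<in> irreducibles P. p \<sqsubseteq>\<^bsub>P\<^esub> r}"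

context
  fixes P :: "('p, 'q) gorder_scheme"
  assumes po: "partial_order P" and GLB: "cond_GLB P" and DC: "cond_DC P" and DD: "cond_DD P"
begin

interpretation partial_order P by (rule po)

lemma is_glb_iff:
  assumes "S \<subseteq> carrier P"
  shows "is_glb P g S \<longleftrightarrow> g \<in> carrier P \<and> (\<forall>s\<in>S. g \<sqsubseteq>\<^bsub>P\<^esub> s) \<and>
    (\<forall>l\<in>carrier P. (\<forall>s\<in>S. l \<sqsubseteq>\<^bsub>P\<^esub> s) \<longrightarrow> l \<sqsubseteq>\<^bsub>P\<^esub> g)"
  using assms by (auto simp: greatest_def Lower_def subset_iff)

lemma irreducibles_carrier: "r \<in> irreducibles P \<Longrightarrow> r \<in> carrier P"
  by (simp add: irreducibles_def)

text \<open>The singleton \<open>{p}\<close> is downward directed with greatest lower bound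
  \<open>p\<close>, so DD applies to it.\<close>

lemma directed_irreducibles_glb:
  assumes "p \<in> carrier P"
  obtains T where "T \<subseteq> irreducibles P" "downward_directed P T" "is_glb P p T"
proof -
  have "downward_directed P {p}" "is_glb P p {p}"
    using assms by (auto simp: downward_directed_def is_glb_iff)
  with DD that show thesis unfolding cond_DD_def by blast
qed

text \<open>DD gives a directed set \<open>T\<close> of irreducibles with greatest lower bound
  \<open>p\<close>. By DC every irreducible above \<open>p\<close> has a member of \<open>T\<close>
  below it, so directedness passes from \<open>T\<close> to the whole set.\<close>

lemma poset_filter_irreducibles_above:
  assumes p: "p \<in> carrier P"
  shows "poset_filter (irreducibles P) (le P) (irreducibles_above P p)"
proof -
  obtain T where T: "T \<subseteq> irreducibles P" "downward_directed P T" "is_glb P p T"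
    using directed_irreducibles_glb[OF p] .
  then have *: "T \<subseteq> carrier P" "T \<noteq> {}"
    and dir: "\<And>p q. p \<in> T \<Longrightarrow> q \<in> T \<Longrightarrow> \<exists>r\<in>T. r \<sqsubseteq>\<^bsub>P\<^esub> p \<and> r \<sqsubseteq>\<^bsub>P\<^esub> q"
    by (auto simp: downward_directed_def)
  have above: "T \<subseteq> irreducibles_above P p"
    using T * by (auto simp: irreducibles_above_def is_glb_iff)
  have below: "\<exists>t\<in>T. t \<sqsubseteq>\<^bsub>P\<^esub> r" if "r \<in> irreducibles_above P p" for r
    using DC T that unfolding cond_DC_def irreducibles_above_def by blast
  show ?thesis unfolding poset_filter_def
  proof (intro conjI ballI impI)
    show "irreducibles_above P p \<subseteq> irreducibles P" by (auto simp: irreducibles_above_def)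
    show "irreducibles_above P p \<noteq> {}" using above * by blast
    show "r \<in> irreducibles_above P p"
      if "q \<in> irreducibles_above P p" "r \<in> irreducibles P" "q \<sqsubseteq>\<^bsub>P\<^esub> r" for q r
      using that p by (auto simp: irreducibles_above_def dest: irreducibles_carrier intro: le_trans)
    show "\<exists>s\<in>irreducibles_above P p. s \<sqsubseteq>\<^bsub>P\<^esub> q \<and> s \<sqsubseteq>\<^bsub>P\<^esub> r"
      if qr: "q \<in> irreducibles_above P p" "r \<in> irreducibles_above P p" for q r
    proof -
      obtain t u where tu: "t \<in> T" "t \<sqsubseteq>\<^bsub>P\<^esub> q" "u \<in> T" "u \<sqsubseteq>\<^bsub>P\<^esub> r"
        using below qr by meson
      then obtain s where s: "s \<in> T" "s \<sqsubseteq>\<^bsub>P\<^esub> t" "s \<sqsubseteq>\<^bsub>P\<^esub> u" using dir by blast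
      have "q \<in> carrier P" "r \<in> carrier P"
        using qr by (auto simp: irreducibles_above_def irreducibles_carrier)
      then have "s \<sqsubseteq>\<^bsub>P\<^esub> q" "s \<sqsubseteq>\<^bsub>P\<^esub> r" using s tu * le_trans by (meson subsetD)+
      then show ?thesis using s above by blast
    qed
  qed
qed

text \<open>A filter is downward directed, so GLB provides the candidate \<open>g\<close>. DC puts a
  member of \<open>F\<close> below each irreducible above \<open>g\<close>, and up-closure then
  returns that irreducible to \<open>F\<close>.\<close>

lemma filter_eq_irreducibles_above:
  assumes F: "poset_filter (irreducibles P) (le P) F"
  shows "\<exists>p\<in>carrier P. F = irreducibles_above P p"
proof -
  have sub: "F \<subseteq> carrier P" using F irreducibles_carrier by (auto simp: poset_filter_def)
  have dd: "downward_directed P F" using F sub unfolding downward_directed_def poset_filter_def by auto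
  then obtain g where g: "is_glb P g F" using GLB unfolding cond_GLB_def by blast
  have "F \<subseteq> irreducibles_above P g"
    using F g sub by (auto simp: irreducibles_above_def is_glb_iff poset_filter_def)
  moreover have "irreducibles_above P g \<subseteq> F"
  proof
    fix r assume r: "r \<in> irreducibles_above P g"
    then obtain s where "s \<in> F" "s \<sqsubseteq>\<^bsub>P\<^esub> r"
      using DC dd g unfolding cond_DC_def irreducibles_above_def by blast
    then show "r \<in> F" using F r unfolding poset_filter_def irreducibles_above_def by blast
  qed
  ultimately show ?thesis using g sub by (auto simp: is_glb_iff)
qed

lemma irreducibles_above_subset_iff:
  assumes p: "p \<in> carrier P" and q: "q \<in> carrier P"
  shows "irreducibles_above P q \<subseteq> irreducibles_above P p \<longleftrightarrow> p \<sqsubseteq>\<^bsub>P\<^esub> q"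
proof
  assume sub: "irreducibles_above P q \<subseteq> irreducibles_above P p"
  obtain T where T: "T \<subseteq> irreducibles P" "is_glb P q T"
    using directed_irreducibles_glb[OF q] by blast
  have Tc: "T \<subseteq> carrier P" using T irreducibles_carrier by blast
  then have "T \<subseteq> irreducibles_above P q" using T by (auto simp: irreducibles_above_def is_glb_iff)
  with sub have "\<forall>t\<in>T. p \<sqsubseteq>\<^bsub>P\<^esub> t" by (auto simp: irreducibles_above_def)
  then show "p \<sqsubseteq>\<^bsub>P\<^esub> q" using T p Tc by (simp add: is_glb_iff)
next
  assume "p \<sqsubseteq>\<^bsub>P\<^esub> q"
  then show "irreducibles_above P q \<subseteq> irreducibles_above P p"
    using p q by (auto simp: irreducibles_above_def dest: irreducibles_carrier intro: le_trans)
qed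

end

section \<open>An algebra of operators indexed by descending words\<close>

type_synonym 'p word = "('p \<times> nat) list"

definition endpoint :: "'p word \<Rightarrow> 'p" where
  "endpoint w = fst (last w)"

lemma endpoint_append_cong:
  "\<lbrakk>endpoint u = endpoint v; u \<noteq> []; v \<noteq> []\<rbrakk> \<Longrightarrow> endpoint (u @ w) = endpoint (v @ w)"
  by (cases "w = []") (simp_all add: endpoint_def)

text \<open>Cutting the common word at the first occurrence of \<open>a\<close> returns both
  \<open>v\<close> and \<open>w\<close>.\<close>

lemma append_fresh_eq:
  assumes "v @ a # s = w @ a # t" "a \<notin> set v" "a \<notin> set w"
  shows "v = w"
proof -
  have *: "takeWhile (\<lambda>x. x \<noteq> a) (u @ a # t) = u" if "a \<notin> set u" for u t
    using that by (induction u) auto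
  show ?thesis using *[of v s] *[of w t] assms by simp
qed

locale word_algebra = field K for K :: "('k, 'r) ring_scheme" (structure) +
  fixes Q :: "'p set" and leq :: "'p \<Rightarrow> 'p \<Rightarrow> bool"
  assumes leq_refl: "p \<in> Q \<Longrightarrow> leq p p"
    and leq_trans: "\<lbrakk>leq p q; leq q r; p \<in> Q; q \<in> Q; r \<in> Q\<rbrakk> \<Longrightarrow> leq p r"
begin

definition paths :: "'p word set" where
  "paths = {w. w \<noteq> [] \<and> fst ` set w \<subseteq> Q \<and> successively (\<lambda>x y. leq (fst y) (fst x)) w}"

definition monomials :: "('p word \<times> 'p word) set" where
  "monomials = {(u, v). u \<in> paths \<and> v \<in> paths \<and> endpoint u = endpoint v}"

definition vecs :: "('p word \<Rightarrow> 'k) set" where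
  "vecs = {f. \<forall>x. f x \<in> carrier K}"

text \<open>A multiple of the partial shift, written on coefficients: at \<open>u @ w\<close> it
  reads \<open>f\<close> at \<open>v @ w\<close>, so it sends the basis vector of
  \<open>v @ w\<close> to \<open>k\<close> times that of \<open>u @ w\<close>. Outside
  \<open>vecs\<close> the value is set to zero, so that operator equations hold for every argument
  \<open>f\<close>.\<close>

definition mon :: "'k \<Rightarrow> 'p word \<times> 'p word \<Rightarrow> ('p word \<Rightarrow> 'k) \<Rightarrow> 'p word \<Rightarrow> 'k" where
  "mon k m f x =
     (if f \<in> vecs \<and> prefix (fst m) x then k \<otimes> f (snd m @ drop (length (fst m)) x) else \<zero>)"

inductive_set span :: "('p word \<times> 'p word) set \<Rightarrow> (('p word \<Rightarrow> 'k) \<Rightarrow> 'p word \<Rightarrow> 'k) set"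
  for S where
  zero: "(\<lambda>f x. \<zero>) \<in> span S"
| add: "\<lbrakk>k \<in> carrier K; m \<in> S; T \<in> span S\<rbrakk> \<Longrightarrow> (\<lambda>f x. mon k m f x \<oplus> T f x) \<in> span S"

definition W :: "('k, ('p word \<Rightarrow> 'k) \<Rightarrow> 'p word \<Rightarrow> 'k) module" where
  "W = \<lparr>carrier = span monomials, monoid.mult = \<lambda>T U f. T (U f), one = undefined,
        ring.zero = \<lambda>f x. \<zero>, ring.add = \<lambda>T U f x. T f x \<oplus> U f x, smult = \<lambda>k T f x. k \<otimes> T f x\<rparr>"

lemma W_simps [simp]:
  "carrier W = span monomials" "T \<otimes>\<^bsub>W\<^esub> U = (\<lambda>f. T (U f))" "\<zero>\<^bsub>W\<^esub> = (\<lambda>f x. \<zero>)"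
  "T \<oplus>\<^bsub>W\<^esub> U = (\<lambda>f x. T f x \<oplus> U f x)" "k \<odot>\<^bsub>W\<^esub> T = (\<lambda>f x. k \<otimes> T f x)"
  by (simp_all add: W_def)

subsection \<open>Paths\<close>

lemma paths_nonempty: "w \<in> paths \<Longrightarrow> w \<noteq> []"
  by (simp add: paths_def)

lemma endpoint_in: "w \<in> paths \<Longrightarrow> endpoint w \<in> Q"
  using last_in_set by (fastforce simp: paths_def endpoint_def)

lemma paths_append_cong:
  assumes "u \<in> paths" "v \<in> paths" "endpoint u = endpoint v" "v @ w \<in> paths"
  shows "u @ w \<in> paths" "endpoint (u @ w) = endpoint (v @ w)"
  using assms endpoint_append_cong[of u v w]
  by (auto simp: paths_def endpoint_def successively_append_iff)

lemma single_path: "q \<in> Q \<Longrightarrow> [(q, n)] \<in> paths"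
  by (simp add: paths_def)

lemma path_snoc: "\<lbrakk>u \<in> paths; q \<in> Q; leq q (endpoint u)\<rbrakk> \<Longrightarrow> u @ [(q, n)] \<in> paths"
  by (simp add: paths_def endpoint_def successively_append_iff)

text \<open>Transitivity turns the comparison of neighbouring letters into one of all pairs;
  reflexivity covers the last letter itself.\<close>

lemma endpoint_le:
  assumes w: "w \<in> paths" and x: "x \<in> set w"
  shows "leq (endpoint w) (fst x)"
proof -
  have Q: "fst y \<in> Q" if "y \<in> set w" for y using w that by (auto simp: paths_def)
  have "successively (\<lambda>x y. leq (fst y) (fst x)) w \<longleftrightarrow> sorted_wrt (\<lambda>x y. leq (fst y) (fst x)) w"
    by (rule successively_iff_sorted_wrt_strong) (use Q leq_trans in blast)
  then have "sorted_wrt (\<lambda>x y. leq (fst y) (fst x)) (butlast w @ [last w])"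
    using w by (simp add: paths_def)
  moreover have "x \<in> set (butlast w) \<or> x = last w"
    using x by (metis in_set_butlastD append_butlast_last_id empty_iff list.set(1) rotate1.simps(2) set_ConsD set_rotate1)
  ultimately show ?thesis
    using Q[OF x] leq_refl by (auto simp: sorted_wrt_append endpoint_def)
qed

lemma endpoint_le_prefix:
  assumes "w \<in> paths" "prefix u w" "u \<noteq> []"
  shows "leq (endpoint w) (endpoint u)"
  using assms endpoint_le[of w "last u"] by (auto simp: endpoint_def prefix_def)

text \<open>Index bookkeeping for products: composing the shift of \<open>(u, v)\<close> with that
  of \<open>(v @ w, z)\<close> gives that of \<open>(u @ w, z)\<close>.\<close>

lemma mono_mult_left: "\<lbrakk>(u, v) \<in> monomials; (v @ w, z) \<in> monomials\<rbrakk> \<Longrightarrow> (u @ w, z) \<in> monomials"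
  using paths_append_cong[of u v w] by (auto simp: monomials_def)

lemma mono_mult_right: "\<lbrakk>(z, u @ w) \<in> monomials; (u, v) \<in> monomials\<rbrakk> \<Longrightarrow> (z, v @ w) \<in> monomials"
  using paths_append_cong[of v u w] by (auto simp: monomials_def)

subsection \<open>Linear operators\<close>

lemma vecsD [simp]: "f \<in> vecs \<Longrightarrow> f x \<in> carrier K"
  by (simp add: vecs_def)

lemma vecsI: "(\<And>x. f x \<in> carrier K) \<Longrightarrow> f \<in> vecs"
  unfolding vecs_def by blast

lemma zero_vec [simp]: "(\<lambda>x. \<zero>) \<in> vecs"
  by (rule vecsI) simp

lemma add_vecs [simp]: "\<lbrakk>f \<in> vecs; g \<in> vecs\<rbrakk> \<Longrightarrow> (\<lambda>x. f x \<oplus> g x) \<in> vecs"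
  by (rule vecsI) simp

lemma smult_vecs [simp]: "\<lbrakk>k \<in> carrier K; f \<in> vecs\<rbrakk> \<Longrightarrow> (\<lambda>x. k \<otimes> f x) \<in> vecs"
  by (rule vecsI) simp

lemma mon_closed [simp]: "k \<in> carrier K \<Longrightarrow> mon k m f x \<in> carrier K"
  by (simp add: mon_def)

lemma mon_vecs [simp]: "k \<in> carrier K \<Longrightarrow> mon k m f \<in> vecs"
  by (rule vecsI) simp

lemma mon_zero [simp]: "mon \<zero> m = (\<lambda>f x. \<zero>)"
  by (simp add: mon_def fun_eq_iff)

lemma mon_apply_zero [simp]: "k \<in> carrier K \<Longrightarrow> mon k m (\<lambda>x. \<zero>) = (\<lambda>x. \<zero>)"
  by (auto simp: mon_def fun_eq_iff)

lemma mon_add: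
  "\<lbrakk>k \<in> carrier K; f \<in> vecs; g \<in> vecs\<rbrakk> \<Longrightarrow>
    mon k m (\<lambda>x. f x \<oplus> g x) = (\<lambda>x. mon k m f x \<oplus> mon k m g x)"
  by (rule ext) (simp add: mon_def r_distr)

lemma mon_smult:
  "\<lbrakk>k \<in> carrier K; l \<in> carrier K; f \<in> vecs\<rbrakk> \<Longrightarrow> mon k m (\<lambda>x. l \<otimes> f x) = (\<lambda>x. l \<otimes> mon k m f x)"
  by (rule ext) (simp add: mon_def m_lcomm)

lemma smult_mon:
  "\<lbrakk>k \<in> carrier K; l \<in> carrier K\<rbrakk> \<Longrightarrow> k \<otimes> mon l m f x = mon (k \<otimes> l) m f x"
  by (simp add: mon_def m_assoc)

section \<open>Spans of monomials as spaces of linear operators\<close>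

lemma span_closed [simp]: "T \<in> span S \<Longrightarrow> T f x \<in> carrier K"
  by (induction arbitrary: x rule: span.induct) auto

lemma span_vecs [simp]: "T \<in> span S \<Longrightarrow> T f \<in> vecs"
  by (rule vecsI) simp

lemma span_apply_add:
  "\<lbrakk>T \<in> span S; f \<in> vecs; g \<in> vecs\<rbrakk> \<Longrightarrow> T (\<lambda>x. f x \<oplus> g x) = (\<lambda>x. T f x \<oplus> T g x)"
  by (induction rule: span.induct) (simp_all add: mon_add a_ac)

lemma span_apply_smult:
  "\<lbrakk>T \<in> span S; k \<in> carrier K; f \<in> vecs\<rbrakk> \<Longrightarrow> T (\<lambda>x. k \<otimes> f x) = (\<lambda>x. k \<otimes> T f x)"
  by (induction rule: span.induct) (simp_all add: mon_smult r_distr)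

lemma span_apply_zero: "T \<in> span S \<Longrightarrow> T (\<lambda>x. \<zero>) = (\<lambda>x. \<zero>)"
  using span_apply_smult[of T S \<zero> "\<lambda>x. \<zero>"] by simp

lemma mon_span: "\<lbrakk>k \<in> carrier K; m \<in> S\<rbrakk> \<Longrightarrow> mon k m \<in> span S"
  using span.add[OF _ _ span.zero, of k m S] by simp

lemma span_add: "\<lbrakk>T \<in> span S; U \<in> span S\<rbrakk> \<Longrightarrow> (\<lambda>f x. T f x \<oplus> U f x) \<in> span S"
proof (induction rule: span.induct)
  case (add k m T)
  then have "(\<lambda>f x. mon k m f x \<oplus> T f x \<oplus> U f x) = (\<lambda>f x. mon k m f x \<oplus> (T f x \<oplus> U f x))"
    by (simp add: a_assoc)
  with add show ?case by (simp add: span.add)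
qed simp

lemma span_smult: "\<lbrakk>T \<in> span S; k \<in> carrier K\<rbrakk> \<Longrightarrow> (\<lambda>f x. k \<otimes> T f x) \<in> span S"
proof (induction rule: span.induct)
  case (add l m T)
  then have "(\<lambda>f x. k \<otimes> (mon l m f x \<oplus> T f x)) = (\<lambda>f x. mon (k \<otimes> l) m f x \<oplus> k \<otimes> T f x)"
    by (simp add: r_distr smult_mon)
  with add show ?case by (simp add: span.add)
qed (simp add: span.zero)

lemma span_mono: "S \<subseteq> S' \<Longrightarrow> T \<in> span S \<Longrightarrow> T \<in> span S'"
  by (rotate_tac, induction rule: span.induct) (auto intro: span.intros)

lemma span_finite: "T \<in> span S \<Longrightarrow> \<exists>S'. finite S' \<and> S' \<subseteq> S \<and> T \<in> span S'"
proof (induction rule: span.induct)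
  case zero
  then show ?case using span.zero by blast
next
  case (add k m T)
  then obtain S' where S': "finite S'" "S' \<subseteq> S" "T \<in> span S'" by blast
  then have "T \<in> span (insert m S')" using span_mono by blast
  then have "(\<lambda>f x. mon k m f x \<oplus> T f x) \<in> span (insert m S')" using add by (simp add: span.add)
  then show ?case using S' add by (intro exI[of _ "insert m S'"]) auto
qed

text \<open>All occurrences of \<open>m\<close> are collected into one coefficient \<open>k\<close>,
  possibly zero.\<close>

lemma span_insert:
  assumes "T \<in> span (insert m S)"
  shows "\<exists>k\<in>carrier K. \<exists>U\<in>span S. T = (\<lambda>f x. mon k m f x \<oplus> U f x)"
  using assms
proof (induction rule: span.induct)
  case zero
  then show ?case by (intro bexI[of _ \<zero>] bexI[of _ "\<lambda>f x. \<zero>"]) (auto simp: span.zero)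
next
  case (add l m' T)
  then obtain k U where U: "k \<in> carrier K" "U \<in> span S" "T = (\<lambda>f x. mon k m f x \<oplus> U f x)" by blast
  show ?case
  proof (cases "m' = m")
    case True
    have "mon l m f x \<oplus> (mon k m f x \<oplus> U f x) = mon (l \<oplus> k) m f x \<oplus> U f x" for f x
      using add U by (auto simp: mon_def l_distr a_assoc)
    then show ?thesis using U add True
      by (intro bexI[of _ "l \<oplus> k"] bexI[of _ U]) (auto intro!: ext)
  next
    case False
    have "mon l m' f x \<oplus> (mon k m f x \<oplus> U f x) = mon k m f x \<oplus> (mon l m' f x \<oplus> U f x)" for f x
      using add U by (simp add: a_lcomm)
    then show ?thesis using U add False
      by (intro bexI[of _ k] bexI[of _ "\<lambda>f x. mon l m' f x \<oplus> U f x"]) (auto intro!: ext intro: span.add)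
  qed
qed

subsection \<open>Products of monomials\<close>

lemma mon_mult_left:
  "\<lbrakk>k \<in> carrier K; l \<in> carrier K\<rbrakk> \<Longrightarrow>
    mon k (u, v) (mon l (v @ w, z) f) = mon (k \<otimes> l) (u @ w, z) f"
  by (rule ext) (auto simp: mon_def prefix_def m_assoc)

lemma mon_mult_right:
  "\<lbrakk>k \<in> carrier K; l \<in> carrier K\<rbrakk> \<Longrightarrow>
    mon k (z, u @ w) (mon l (u, v) f) = mon (k \<otimes> l) (z, v @ w) f"
  by (rule ext) (auto simp: mon_def prefix_def m_assoc)

lemma mon_mult_match:
  "\<lbrakk>k \<in> carrier K; l \<in> carrier K\<rbrakk> \<Longrightarrow> mon k (u, v) (mon l (v, z) f) = mon (k \<otimes> l) (u, z) f"
  using mon_mult_left[of k l u v "[]"] by simp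

text \<open>No word has both of two incomparable words as prefixes, so the inner operator vanishes
  wherever the outer one reads it.\<close>

lemma mon_mult_zero:
  assumes "k \<in> carrier K" "\<not> prefix v w" "\<not> prefix w v"
  shows "mon k (u, v) (mon l (w, z) f) = (\<lambda>x. \<zero>)"
proof -
  have "\<not> prefix w (v @ t)" for t
    using assms by (meson prefixI prefix_same_cases)
  then show ?thesis using assms(1) by (auto simp: mon_def fun_eq_iff)
qed

text \<open>The inner words are comparable in one of two ways or not at all. The prefix relations of
  \<open>n\<close> are recorded because they bound its end vertex from above.\<close>

lemma mon_mult_cases:
  assumes "m \<in> monomials" "m' \<in> monomials" "k \<in> carrier K" "l \<in> carrier K"
  obtains (zero) "(\<lambda>f. mon k m (mon l m' f)) = (\<lambda>f x. \<zero>)"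
  | (mono) n where "n \<in> monomials" "prefix (fst m) (fst n)" "prefix (snd m') (snd n)"
      "(\<lambda>f. mon k m (mon l m' f)) = mon (k \<otimes> l) n"
proof -
  obtain u v w z where [simp]: "m = (u, v)" "m' = (w, z)" by (metis surj_pair)
  consider t where "w = v @ t" | t where "v = w @ t" | "\<not> prefix v w" "\<not> prefix w v"
    by (auto simp: prefix_def)
  then show thesis
  proof cases
    case 1
    show thesis
      by (rule mono[of "(u @ t, z)"]) (use 1 assms mono_mult_left mon_mult_left in auto)
  next
    case 2
    show thesis
      by (rule mono[of "(u, z @ t)"]) (use 2 assms mono_mult_right mon_mult_right in auto)
  next
    case 3
    then show thesis using zero assms mon_mult_zero by simp
  qed
qed

lemma span_mult:
  assumes T: "T \<in> span monomials" and U: "U \<in> span monomials"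
  shows "(\<lambda>f. T (U f)) \<in> span monomials"
proof -
  have *: "(\<lambda>f. mon k m (U f)) \<in> span monomials" if k: "k \<in> carrier K" and m: "m \<in> monomials" for k m
    using U
  proof (induction rule: span.induct)
    case zero
    then show ?case using k by (simp add: span.zero)
  next
    case (add l m' U)
    then have "(\<lambda>f. mon k m (\<lambda>x. mon l m' f x \<oplus> U f x)) =
        (\<lambda>f x. mon k m (mon l m' f) x \<oplus> mon k m (U f) x)"
      using k by (simp add: mon_add)
    moreover have "(\<lambda>f. mon k m (mon l m' f)) \<in> span monomials"
    proof -
      from m \<open>m' \<in> monomials\<close> k \<open>l \<in> carrier K\<close> show ?thesis
        by (cases rule: mon_mult_cases) (use k add.hyps in \<open>simp_all add: span.zero mon_span\<close>)
    qed
    ultimately show ?case using span_add add.IH by simp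
  qed
  show ?thesis using T
  proof (induction rule: span.induct)
    case zero
    then show ?case by (simp add: span.zero)
  next
    case (add k m T)
    then show ?case using span_add[OF *[OF add.hyps(1,2)] add.IH] by simp
  qed
qed

section \<open>The associative algebra formed by the operators\<close>

lemma assoc_algebra_W: "assoc_algebra K W"
proof -
  have "abelian_group W"
  proof (rule abelian_groupI)
    show "\<exists>U\<in>carrier W. U \<oplus>\<^bsub>W\<^esub> T = \<zero>\<^bsub>W\<^esub>" if "T \<in> carrier W" for T
    proof -
      have "\<ominus> \<one> \<otimes> T f x \<oplus> T f x = \<zero>" for f x
        using that by (simp add: l_minus l_neg)
      then show ?thesis using that span_smult[of T monomials "\<ominus> \<one>"]
        by (intro bexI[of _ "\<lambda>f x. \<ominus> \<one> \<otimes> T f x"]) auto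
    qed
  qed (auto simp: span_add span.zero a_ac)
  then have "module K W"
    by (intro moduleI is_cring) (auto simp: span_smult l_distr r_distr m_assoc)
  then show ?thesis
    by (intro assoc_algebra.intro assoc_algebra_axioms.intro field_axioms)
      (auto simp: span_mult span_apply_add span_apply_smult)
qed

sublocale W: assoc_algebra K W
  by (rule assoc_algebra_W)

subsection \<open>Ideals are spanned by monomials\<close>

definition ideal_monos :: "(('p word \<Rightarrow> 'k) \<Rightarrow> 'p word \<Rightarrow> 'k) set \<Rightarrow> ('p word \<times> 'p word) set" where
  "ideal_monos I = {m \<in> monomials. mon \<one> m \<in> I}"

context
  fixes I assumes I: "two_sided_ideal I W"
begin

lemma ideal_span: "T \<in> I \<Longrightarrow> T \<in> span monomials"
  using two_sided_idealD(1)[OF I] by auto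

lemma ideal_add: "\<lbrakk>T \<in> I; U \<in> I\<rbrakk> \<Longrightarrow> (\<lambda>f x. T f x \<oplus> U f x) \<in> I"
  using two_sided_idealD(3)[OF I] by simp

lemma ideal_mult:
  "\<lbrakk>T \<in> I; U \<in> span monomials\<rbrakk> \<Longrightarrow> (\<lambda>f. T (U f)) \<in> I"
  "\<lbrakk>T \<in> I; U \<in> span monomials\<rbrakk> \<Longrightarrow> (\<lambda>f. U (T f)) \<in> I"
  using two_sided_idealD(4,5)[OF I] by simp_all

lemma ideal_mult_both:
  assumes "T \<in> I" "U \<in> span monomials" "V \<in> span monomials"
  shows "(\<lambda>f. U (T (V f))) \<in> I"
  using ideal_mult(2)[OF ideal_mult(1)[OF assms(1,3)] assms(2)] .

lemma ideal_zero: "(\<lambda>f x. \<zero>) \<in> I"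
  using two_sided_idealD(2)[OF I] by simp

text \<open>Multiplying by the shifts of \<open>(u', u)\<close> and \<open>(v, v')\<close> replaces
  both words, so membership depends only on the end vertex. The scalar \<open>l\<close> is carried
  by the left factor, as ideals are not assumed closed under scalars.\<close>

lemma ideal_mon_change:
  assumes "mon k (u, v) \<in> I" "(u, v) \<in> monomials" "(u', v') \<in> monomials" "endpoint u = endpoint u'"
    and "k \<in> carrier K" "l \<in> carrier K"
  shows "mon (l \<otimes> k) (u', v') \<in> I"
proof -
  have "(u', u) \<in> monomials" "(v, v') \<in> monomials" using assms by (auto simp: monomials_def)
  then have "(\<lambda>f. mon l (u', u) (mon k (u, v) (mon \<one> (v, v') f))) \<in> I"
    using assms by (intro ideal_mult_both[OF assms(1) mon_span mon_span]) auto
  then show ?thesis using assms by (simp add: mon_mult_match)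
qed

lemma ideal_mon_iff:
  assumes "(u, v) \<in> monomials" "k \<in> carrier K" "k \<noteq> \<zero>"
  shows "mon k (u, v) \<in> I \<longleftrightarrow> (u, v) \<in> ideal_monos I"
proof
  assume "mon k (u, v) \<in> I"
  then have "mon (inv k \<otimes> k) (u, v) \<in> I" using assms field_Units by (intro ideal_mon_change) auto
  then show "(u, v) \<in> ideal_monos I" using assms field_Units by (simp add: ideal_monos_def)
next
  assume "(u, v) \<in> ideal_monos I"
  then have "mon (k \<otimes> \<one>) (u, v) \<in> I"
    using assms by (intro ideal_mon_change) (auto simp: ideal_monos_def)
  then show "mon k (u, v) \<in> I" using assms by simp
qed

lemma span_ideal_monos: "T \<in> span (ideal_monos I) \<Longrightarrow> T \<in> I"
proof (induction rule: span.induct)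
  case (add k m T)
  obtain u v where m: "m = (u, v)" by fastforce
  have "mon k m \<in> I"
  proof (cases "k = \<zero>")
    case True
    then show ?thesis by (simp add: ideal_zero)
  next
    case False
    then show ?thesis using add ideal_mon_iff m by (simp add: ideal_monos_def)
  qed
  then show ?case using add ideal_add by blast
qed (rule ideal_zero)

text \<open>A monomial with left word of minimal length is isolated by multiplying on both sides
  with monomials involving a letter that occurs in none of the words.\<close>

lemma sandwich_zero:
  assumes "(u', v') \<noteq> (u, v)" "length u \<le> length u'" "a \<notin> set u'" "a \<notin> set v'" "a \<notin> set v"
    and "k \<in> carrier K" "l \<in> carrier K" "j \<in> carrier K"
  shows "mon j (u, u @ [a]) (mon k (u', v') (mon l (v @ [a], v) f)) = (\<lambda>x. \<zero>)"
proof -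
  \<comment> \<open>The outer monomial reads its argument only at words of the form
    \<open>u @ a # z\<close>.\<close>
  have "mon k (u', v') (mon l (v @ [a], v) f) (u @ a # z) = \<zero>" for z
  proof (cases "prefix u' (u @ a # z)")
    case True
    then obtain t where t: "u @ a # z = u' @ t" by (auto simp: prefix_def)
    with assms(2) obtain s where s: "u' = u @ s" "a # z = s @ t"
      by (auto simp: append_eq_append_conv2)
    \<comment> \<open>A nonempty \<open>s\<close> would start with \<open>a\<close>, which does not
      occur in \<open>u'\<close>.\<close>
    with assms(3) have "s = []" by (cases s) auto
    with s assms(1) have "u' = u" "v' \<noteq> v" by auto
    have "\<not> prefix (v @ [a]) (v' @ a # z)"
      using append_fresh_eq[of v a _ v' z] \<open>v' \<noteq> v\<close> assms(4,5) by (auto simp: prefix_def)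
    then show ?thesis using \<open>u' = u\<close> assms(6) by (simp add: mon_def)
  next
    case False
    then show ?thesis by (simp add: mon_def)
  qed
  then show ?thesis using assms(8) by (auto simp: mon_def[of j] prefix_def)
qed

text \<open>Induction on the number of monomials: the sandwich extracts one term of \<open>T\<close>
  as an element of \<open>I\<close>, and subtracting it leaves an element of \<open>I\<close> over
  fewer monomials.\<close>

lemma ideal_subset_span_finite:
  assumes "finite S" "S \<subseteq> monomials" "T \<in> span S" "T \<in> I"
  shows "T \<in> span (ideal_monos I)"
  using assms
proof (induction "card S" arbitrary: S T rule: less_induct)
  case less
  show ?case
  proof (cases "S = {}")
    case True
    with less.prems(3) have "T = (\<lambda>f x. \<zero>)" by cases auto
    then show ?thesis by (simp add: span.zero)
  next
    case False
    then obtain m where m: "m \<in> S" "\<forall>m'\<in>S. length (fst m) \<le> length (fst m')"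
      using ex_has_least_nat[of "\<lambda>m. m \<in> S" _ "\<lambda>m. length (fst m)"] by blast
    obtain u v where uv: "m = (u, v)" by fastforce
    define S' where "S' = S - {m}"
    have S': "S = insert m S'" "m \<notin> S'" "S' \<subseteq> monomials" "finite S'" "card S' < card S"
      using m less.prems card_Diff1_less[of S m] by (auto simp: S'_def)
    obtain k U where U: "k \<in> carrier K" "U \<in> span S'" "T = (\<lambda>f x. mon k m f x \<oplus> U f x)"
      using span_insert less.prems(3) S'(1) by blast
    \<comment> \<open>\<open>N\<close> collects the labels of all letters in \<open>S\<close>, so a
      label outside \<open>N\<close> gives a fresh letter. Taking \<open>endpoint u\<close> as its
      vertex keeps \<open>u @ [a]\<close> and \<open>v @ [a]\<close> paths with the same
      end.\<close>
    define N where "N = (\<Union>(w, z)\<in>S. snd ` (set w \<union> set z))"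
    have "finite N" using less.prems(1) by (auto simp: N_def)
    then obtain n where n: "n \<notin> N" using ex_new_if_finite infinite_UNIV_nat by blast
    define a where "a = (endpoint u, n)"
    have fresh: "a \<notin> set w" "a \<notin> set z" if "(w, z) \<in> S" for w z
      using n that by (force simp: N_def a_def)+
    have mm: "(u, v) \<in> monomials" using m uv less.prems(2) by auto
    then have "u @ [a] \<in> paths" "v @ [a] \<in> paths"
      using path_snoc endpoint_in leq_refl by (auto simp: monomials_def a_def)
    then have ua: "(u, u @ [a]) \<in> monomials" and va: "(v @ [a], v) \<in> monomials"
      using mm by (auto simp: monomials_def endpoint_def[of "_ @ _"] a_def)
    define sw :: "(('p word \<Rightarrow> 'k) \<Rightarrow> 'p word \<Rightarrow> 'k) \<Rightarrow> ('p word \<Rightarrow> 'k) \<Rightarrow> 'p word \<Rightarrow> 'k"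
      where "sw = (\<lambda>Y f. mon \<one> (u, u @ [a]) (Y (mon \<one> (v @ [a], v) f)))"
    have sw_add: "sw (\<lambda>f x. Y f x \<oplus> Z f x) = (\<lambda>f x. sw Y f x \<oplus> sw Z f x)"
      if "\<And>f. Y f \<in> vecs" "\<And>f. Z f \<in> vecs" for Y Z
      using that by (simp add: sw_def mon_add)
    have "sw Y = (\<lambda>f x. \<zero>)" if "Y \<in> span S'" for Y
      using that
    proof (induction rule: span.induct)
      case zero
      then show ?case by (simp add: sw_def mon_def fun_eq_iff)
    next
      case (add l m' Y)
      obtain w z where wz: "m' = (w, z)" by fastforce
      have "sw (mon l m') = (\<lambda>f x. \<zero>)"
      proof -
        have mem: "(w, z) \<in> S" "(u, v) \<in> S" "(w, z) \<noteq> (u, v)" "length u \<le> length w"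
          using add.hyps m S' wz uv by auto
        show ?thesis unfolding sw_def wz
          by (intro ext fun_cong[OF sandwich_zero])
            (use mem(3,4) fresh[OF mem(1)] fresh[OF mem(2)] add.hyps in simp_all)
      qed
      moreover have "sw (\<lambda>f x. mon l m' f x \<oplus> Y f x) = (\<lambda>f x. sw (mon l m') f x \<oplus> sw Y f x)"
        using add.hyps by (intro sw_add) auto
      ultimately show ?case using add.IH by simp
    qed
    then have "sw U = (\<lambda>f x. \<zero>)" using U by blast
    \<comment> \<open>The chosen monomial survives: the left factor lengthens \<open>v\<close> to
      \<open>v @ [a]\<close>, and the right factor shortens it back.\<close>
    moreover have "sw (mon k m) = mon k m"
      using U mon_mult_right[of \<one> k u u "[a]" v] mon_mult_match[of k \<one> u "v @ [a]" v]
      by (simp add: sw_def uv fun_eq_iff)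
    moreover have "sw T = (\<lambda>f x. sw (mon k m) f x \<oplus> sw U f x)"
      unfolding U(3) using U(1,2) by (intro sw_add) auto
    ultimately have "sw T = mon k m" using U by simp
    moreover have "sw T \<in> I"
      unfolding sw_def using ua va less.prems(4)
      by (intro ideal_mult_both[OF less.prems(4) mon_span mon_span]) auto
    ultimately have mon_I: "mon k m \<in> I" by simp
    have "(\<lambda>f x. mon (\<ominus> k) m f x) \<in> I"
      using ideal_mon_change[of k u v u v "\<ominus> \<one>"] mon_I mm U uv by (simp add: l_minus)
    then have "(\<lambda>f x. mon (\<ominus> k) m f x \<oplus> T f x) \<in> I" using less.prems(4) ideal_add by blast
    moreover have "mon (\<ominus> k) m f x \<oplus> T f x = U f x" for f x
      using U by (auto simp: mon_def l_minus r_neg1)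
    ultimately have "U \<in> I" by simp
    then have U': "U \<in> span (ideal_monos I)" using less.hyps[of S' U] S' U by blast
    show ?thesis
    \<comment> \<open>A zero coefficient does not place \<open>m\<close> in
      \<open>ideal_monos I\<close>, but then \<open>T\<close> is just \<open>U\<close>.\<close>
    proof (cases "k = \<zero>")
      case True
      then have "T = U" using U by simp
      then show ?thesis using U' by simp
    next
      case False
      then have "m \<in> ideal_monos I" using ideal_mon_iff mm mon_I U uv by simp
      then show ?thesis using U U' by (simp add: span.add)
    qed
  qed
qed

lemma ideal_eq_span: "I = span (ideal_monos I)"
proof
  show "I \<subseteq> span (ideal_monos I)"
  proof
    fix T assume T: "T \<in> I"
    then obtain S where "finite S" "S \<subseteq> monomials" "T \<in> span S"
      using span_finite ideal_span by meson
    then show "T \<in> span (ideal_monos I)" using T ideal_subset_span_finite by blast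
  qed
qed (use span_ideal_monos in blast)

end

subsection \<open>Prime ideals and filters\<close>

text \<open>For a filter \<open>F\<close> this is the span of the monomials whose end vertex is
  outside \<open>F\<close>. Phrased by vanishing at words, it is visibly closed under multiplication
  on the right.\<close>

definition filter_ideal :: "'p set \<Rightarrow> (('p word \<Rightarrow> 'k) \<Rightarrow> 'p word \<Rightarrow> 'k) set" where
  "filter_ideal F = {T \<in> span monomials. \<forall>f. \<forall>w\<in>paths. endpoint w \<in> F \<longrightarrow> T f w = \<zero>}"

text \<open>The vertex idempotent of \<open>q\<close>. The label \<open>0\<close> is an arbitrary
  choice, as an ideal sees only the end vertex of a monomial.\<close>

definition idem :: "'p \<Rightarrow> ('p word \<Rightarrow> 'k) \<Rightarrow> 'p word \<Rightarrow> 'k" where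
  "idem q = mon \<one> ([(q, 0)], [(q, 0)])"

lemma single_monomial: "q \<in> Q \<Longrightarrow> ([(q, n)], [(q, n)]) \<in> monomials"
  by (simp add: monomials_def single_path)

text \<open>A shift exchanges prefixes with the same end vertex, so its value at a word ending in
  \<open>F\<close> is computed from a value of \<open>g\<close> at another such word.\<close>

lemma span_preserves_vanishing:
  assumes "T \<in> span monomials" "g \<in> vecs" "\<And>w. \<lbrakk>w \<in> paths; endpoint w \<in> F\<rbrakk> \<Longrightarrow> g w = \<zero>"
    and "w \<in> paths" "endpoint w \<in> F"
  shows "T g w = \<zero>"
  using assms(1)
proof (induction rule: span.induct)
  case (add k m T)
  obtain u v where m: "m = (u, v)" by fastforce
  have "mon k m g w = \<zero>"
  proof (cases "prefix u w")
    case True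
    then obtain z where z: "w = u @ z" by (auto simp: prefix_def)
    have "v @ z \<in> paths" "endpoint (v @ z) = endpoint (u @ z)"
      using paths_append_cong[of v u z] add.hyps assms(4) m z by (auto simp: monomials_def)
    then have "g (v @ z) = \<zero>" using assms(3,5) z by simp
    then show ?thesis using add.hyps by (simp add: mon_def m z)
  qed (simp add: mon_def m)
  then show ?case using add.IH by simp
qed simp

lemma filter_ideal_smult:
  "\<lbrakk>k \<in> carrier K; T \<in> filter_ideal F\<rbrakk> \<Longrightarrow> k \<odot>\<^bsub>W\<^esub> T \<in> filter_ideal F"
  by (auto simp: filter_ideal_def span_smult)

lemma filter_ideal_ideal: "two_sided_ideal (filter_ideal F) W"
  unfolding two_sided_ideal_def
proof (intro conjI W.subspace_additive_subgroup ballI filter_ideal_smult)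
  fix T U assume T: "T \<in> filter_ideal F" and U: "U \<in> carrier W"
  show "U \<otimes>\<^bsub>W\<^esub> T \<in> filter_ideal F"
  proof -
    have "U (T f) w = \<zero>" if "w \<in> paths" "endpoint w \<in> F" for f w
      by (rule span_preserves_vanishing[of U _ F])
        (use T U that span_vecs in \<open>auto simp: filter_ideal_def\<close>)
    then show ?thesis using T U by (simp add: filter_ideal_def span_mult)
  qed
  show "T \<otimes>\<^bsub>W\<^esub> U \<in> filter_ideal F"
    using T U by (auto simp: filter_ideal_def span_mult)
qed (auto simp: filter_ideal_def span.zero span_add)

lemma filterD:
  assumes "poset_filter Q leq F"
  shows "F \<subseteq> Q" "F \<noteq> {}" "\<And>p q. \<lbrakk>p \<in> F; q \<in> Q; leq p q\<rbrakk> \<Longrightarrow> q \<in> F"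
    "\<And>p q. \<lbrakk>p \<in> F; q \<in> F\<rbrakk> \<Longrightarrow> \<exists>r\<in>F. leq r p \<and> leq r q"
  using assms by (auto simp: poset_filter_def)

text \<open>The constant vector \<open>\<one>\<close> detects a monomial at the word
  \<open>u\<close> itself. Conversely, a word with prefix \<open>u\<close> ends below
  \<open>endpoint u\<close>; if its end were in \<open>F\<close>, up-closure would put
  \<open>endpoint u\<close> in \<open>F\<close>.\<close>

lemma mon_filter_ideal_iff:
  assumes F: "poset_filter Q leq F"
    and m: "(u, v) \<in> monomials" and k: "k \<in> carrier K" "k \<noteq> \<zero>"
  shows "mon k (u, v) \<in> filter_ideal F \<longleftrightarrow> endpoint u \<notin> F"
proof
  assume mem: "mon k (u, v) \<in> filter_ideal F"
  have "(\<lambda>x. \<one>) \<in> vecs" by (rule vecsI) simp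
  then have "mon k (u, v) (\<lambda>x. \<one>) u = k" using k by (simp add: mon_def)
  with mem m k show "endpoint u \<notin> F" by (auto simp: filter_ideal_def monomials_def)
next
  assume u: "endpoint u \<notin> F"
  have "mon k (u, v) f w = \<zero>" if w: "w \<in> paths" "endpoint w \<in> F" for f w
  proof -
    have "\<not> prefix u w"
      using u w filterD(3)[OF F] endpoint_le_prefix[OF w(1), of u] m paths_nonempty endpoint_in
      by (auto simp: monomials_def)
    then show ?thesis by (simp add: mon_def)
  qed
  then show "mon k (u, v) \<in> filter_ideal F" using m k by (auto simp: filter_ideal_def mon_span)
qed

text \<open>Both ideals are spanned by their monomials, so a failing inclusion is already witnessed
  by a monomial.\<close>

lemma exists_monomial_outside:
  assumes F: "poset_filter Q leq F" and J: "two_sided_ideal J W" and T: "T \<in> J" "T \<notin> filter_ideal F"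
  obtains u v where "(u, v) \<in> monomials" "mon \<one> (u, v) \<in> J" "endpoint u \<in> F"
proof -
  have "\<not> ideal_monos J \<subseteq> ideal_monos (filter_ideal F)"
  proof
    assume "ideal_monos J \<subseteq> ideal_monos (filter_ideal F)"
    then have "T \<in> span (ideal_monos (filter_ideal F))"
      using T(1) ideal_eq_span[OF J] span_mono by blast
    then show False using T(2) ideal_eq_span[OF filter_ideal_ideal] by blast
  qed
  then obtain u v where uv: "(u, v) \<in> monomials" "mon \<one> (u, v) \<in> J" "mon \<one> (u, v) \<notin> filter_ideal F"
    by (auto simp: ideal_monos_def)
  moreover have "endpoint u \<in> F"
    using mon_filter_ideal_iff[OF F uv(1), where k = "\<one>"] uv(3) by auto
  ultimately show thesis using that by blast
qed

text \<open>The quotient ideals reduce a failure of primeness to two monomials that end in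
  \<open>F\<close>. Directedness gives \<open>r\<close> in \<open>F\<close> below both ends, through
  which the two are joined to a product outside the ideal.\<close>

lemma prime_filter_ideal:
  assumes F: "poset_filter Q leq F"
  shows "prime_ideal (filter_ideal F) W"
  unfolding prime_ideal_def
proof (intro conjI ballI impI filter_ideal_ideal)
  note D = filterD[OF F]
  note iff = mon_filter_ideal_iff[OF F]
  obtain q where q: "q \<in> F" using D(2) by blast
  have "idem q \<notin> filter_ideal F" "idem q \<in> carrier W"
    using q D(1) iff[OF single_monomial[of q 0], where k = "\<one>"] single_monomial
    by (auto simp: idem_def endpoint_def mon_span)
  then show "filter_ideal F \<noteq> carrier W" by blast
  fix T U assume TU: "T \<in> carrier W" "U \<in> carrier W"
    and prod: "\<forall>R\<in>carrier W. T \<otimes>\<^bsub>W\<^esub> R \<otimes>\<^bsub>W\<^esub> U \<in> filter_ideal F"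
  show "T \<in> filter_ideal F \<or> U \<in> filter_ideal F"
  proof (rule ccontr)
    assume out: "\<not> (T \<in> filter_ideal F \<or> U \<in> filter_ideal F)"
    let ?J = "{T \<in> carrier W. \<forall>R\<in>carrier W. T \<otimes>\<^bsub>W\<^esub> R \<otimes>\<^bsub>W\<^esub> U \<in> filter_ideal F}"
    have "two_sided_ideal ?J W"
      using TU by (intro W.left_quotient_ideal filter_ideal_ideal filter_ideal_smult)
    moreover have "T \<in> ?J" using TU prod by blast
    ultimately obtain u v where uv: "(u, v) \<in> monomials" "mon \<one> (u, v) \<in> ?J" "endpoint u \<in> F"
      using out by (elim exists_monomial_outside[OF F]) auto
    let ?L = "{Y \<in> carrier W. \<forall>R\<in>carrier W. mon \<one> (u, v) \<otimes>\<^bsub>W\<^esub> R \<otimes>\<^bsub>W\<^esub> Y \<in> filter_ideal F}"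
    have "two_sided_ideal ?L W"
      using uv by (intro W.right_quotient_ideal filter_ideal_ideal filter_ideal_smult) auto
    moreover have "U \<in> ?L" using TU uv(2) by blast
    ultimately obtain w z where wz: "(w, z) \<in> monomials" "mon \<one> (w, z) \<in> ?L" "endpoint w \<in> F"
      using out by (elim exists_monomial_outside[OF F]) auto
    obtain r where r: "r \<in> F" "leq r (endpoint u)" "leq r (endpoint w)"
      using D(4) uv(3) wz(3) by blast
    let ?r = "[(r, 0)]"
    have "u @ ?r \<in> paths" "v @ ?r \<in> paths" "w @ ?r \<in> paths" "z @ ?r \<in> paths"
      using path_snoc r D(1) uv(1) wz(1) by (auto simp: monomials_def)
    then have mons: "(v @ ?r, w @ ?r) \<in> monomials" "(u @ ?r, z @ ?r) \<in> monomials"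
      by (auto simp: monomials_def endpoint_def)
    \<comment> \<open>The middle factor extends \<open>v\<close> and \<open>w\<close> by the same
      letter, so nothing cancels and the product ends at \<open>r\<close>.\<close>
    have "(\<lambda>f. mon \<one> (u, v) (mon \<one> (v @ ?r, w @ ?r) (mon \<one> (w, z) f))) = mon \<one> (u @ ?r, z @ ?r)"
      by (simp add: mon_mult_left mon_mult_right fun_eq_iff)
    moreover have "(\<lambda>f. mon \<one> (u, v) (mon \<one> (v @ ?r, w @ ?r) (mon \<one> (w, z) f))) \<in> filter_ideal F"
      using wz(2) mons(1) mon_span[of \<one> _ monomials] by auto
    ultimately have "mon \<one> (u @ ?r, z @ ?r) \<in> filter_ideal F" by simp
    then show False using iff[OF mons(2), where k = "\<one>"] r(1) by (simp add: endpoint_def)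
  qed
qed

text \<open>A monomial multiplied by \<open>idem p\<close> on the left and \<open>idem q\<close> on
  the right is zero or a multiple of a monomial whose words start at \<open>p\<close> and
  \<open>q\<close>; their common end lies below both. Without a suitable \<open>r\<close> all these
  products lie in \<open>I\<close>, against primeness.\<close>

lemma prime_ideal_directed:
  assumes I: "prime_ideal I W" and pq: "p \<in> Q" "q \<in> Q" "idem p \<notin> I" "idem q \<notin> I"
  shows "\<exists>r\<in>Q. idem r \<notin> I \<and> leq r p \<and> leq r q"
proof (rule ccontr)
  assume none: "\<not> ?thesis"
  have ideal: "two_sided_ideal I W" using I by (simp add: prime_ideal_def)
  note sm = single_monomial[of _ 0]
  have mon: "(\<lambda>f. idem p (mon k m (idem q f))) \<in> I" if k: "k \<in> carrier K" and m: "m \<in> monomials" for k m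
    using sm[OF pq(1)] m one_closed k
  proof (cases rule: mon_mult_cases)
    case zero
    then have "(\<lambda>f. idem p (mon k m (idem q f))) = (\<lambda>f x. \<zero>)"
      by (simp add: idem_def fun_eq_iff)
    then show ?thesis using ideal_zero[OF ideal] by simp
  next
    case (mono n)
    have eq: "(\<lambda>f. idem p (mon k m (idem q f))) = (\<lambda>f. mon k n (mon \<one> ([(q, 0)], [(q, 0)]) f))"
      using fun_cong[OF mono(4)] k by (simp add: idem_def)
    show ?thesis
      using mono(1) sm[OF pq(2)] k one_closed
    proof (cases rule: mon_mult_cases)
      case zero
      then show ?thesis using eq ideal_zero[OF ideal] by simp
    next
      case (mono n')
      obtain u v where n': "n' = (u, v)" by fastforce
      have uv: "(u, v) \<in> monomials" "u \<in> paths" "v \<in> paths" "endpoint u = endpoint v"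
        using mono(1) n' by (auto simp: monomials_def)
      \<comment> \<open>The first product makes the left word of \<open>n\<close> start with
        \<open>(p, 0)\<close>; the second only extends that word and makes the right one start with
        \<open>(q, 0)\<close>.\<close>
      have "prefix [(p, 0)] u" "prefix [(q, 0)] v"
        using mono \<open>prefix (fst ([(p, 0)], [(p, 0)])) (fst n)\<close> n' prefix_order.trans by auto
      then have "leq (endpoint u) p" "leq (endpoint u) q"
        using endpoint_le_prefix uv by (fastforce simp: endpoint_def[of "[_]"])+
      then have "idem (endpoint u) \<in> I" using none endpoint_in uv by blast
      then have "mon (k \<otimes> \<one>) n' \<in> I"
        unfolding idem_def n'
        by (rule ideal_mon_change[OF ideal])
          (use uv k endpoint_in single_monomial in \<open>auto simp: endpoint_def[of "[_]"]\<close>)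
      then show ?thesis using eq mono(4) by simp
    qed
  qed
  have "(\<lambda>f. idem p (R (idem q f))) \<in> I" if "R \<in> span monomials" for R
    using that
  proof (induction rule: span.induct)
    case zero
    then show ?case using ideal_zero[OF ideal] by (simp add: idem_def)
  next
    case (add k m R)
    then have "(\<lambda>f x. idem p (mon k m (idem q f)) x \<oplus> idem p (R (idem q f)) x) \<in> I"
      using ideal_add[OF ideal mon[of k m] add.IH] by simp
    then show ?case using add.hyps by (simp add: idem_def mon_add)
  qed
  moreover have "idem p \<in> carrier W" "idem q \<in> carrier W"
    using sm pq by (auto simp: idem_def mon_span)
  ultimately have "idem p \<in> I \<or> idem q \<in> I"
    using I unfolding prime_ideal_def by simp
  then show False using pq by blast
qed

lemma mon_mem_ideal_iff:
  assumes I: "two_sided_ideal I W" and m: "(u, v) \<in> monomials"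
  shows "mon \<one> (u, v) \<in> I \<longleftrightarrow> idem (endpoint u) \<in> I"
proof -
  let ?e = "[(endpoint u, 0)]"
  have e: "(?e, ?e) \<in> monomials" "endpoint ?e = endpoint u"
    using m endpoint_in by (auto simp: monomials_def single_path endpoint_def[of "[_]"])
  show ?thesis
    using ideal_mon_change[OF I _ m e(1) e(2)[symmetric], of \<one> \<one>]
      ideal_mon_change[OF I _ e(1) m e(2), of \<one> \<one>] by (auto simp: idem_def)
qed

text \<open>Let \<open>F\<close> be the set of vertices whose idempotents are outside
  \<open>I\<close>. Once \<open>F\<close> is known to be a filter, \<open>I\<close> and
  \<open>filter_ideal F\<close> contain the same monomials, and these determine an ideal.\<close>

lemma prime_ideal_eq_filter_ideal:
  assumes I: "prime_ideal I W"
  shows "\<exists>F. poset_filter Q leq F \<and> I = filter_ideal F"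
proof -
  have ideal: "two_sided_ideal I W" and proper: "I \<noteq> carrier W"
    using I by (auto simp: prime_ideal_def)
  define F where "F = {q \<in> Q. idem q \<notin> I}"
  have mon_mem: "mon \<one> (u, v) \<in> I \<longleftrightarrow> endpoint u \<notin> F" if "(u, v) \<in> monomials" for u v
    using mon_mem_ideal_iff[OF ideal that] endpoint_in that by (auto simp: F_def monomials_def)
  have up: "q \<in> F" if "p \<in> F" "q \<in> Q" "leq p q" for p q
  proof (rule ccontr)
    assume "q \<notin> F"
    then have "mon \<one> ([(q, 0)], [(q, 0)]) \<in> I" using that by (simp add: F_def idem_def)
    \<comment> \<open>As \<open>p\<close> lies below \<open>q\<close>, there is a path from
      \<open>q\<close> to \<open>p\<close>. Its monomial is fixed by the idempotent of
      \<open>q\<close> but ends at \<open>p\<close>.\<close>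
    have paths: "[(q, 0)] \<in> paths" "[(q, 0), (p, 0)] \<in> paths"
      using path_snoc[of "[(q, 0)]" p 0] single_path that by (auto simp: F_def endpoint_def)
    then have m: "([(q, 0), (p, 0)], [(q, 0), (p, 0)]) \<in> monomials" by (simp add: monomials_def)
    have "(\<lambda>f. mon \<one> ([(q, 0)], [(q, 0)]) (mon \<one> ([(q, 0), (p, 0)], [(q, 0), (p, 0)]) f)) \<in> I"
      by (rule ideal_mult(1)[OF ideal \<open>mon \<one> ([(q, 0)], [(q, 0)]) \<in> I\<close> mon_span[OF one_closed m]])
    then have "mon \<one> ([(q, 0), (p, 0)], [(q, 0), (p, 0)]) \<in> I"
      using mon_mult_left[of \<one> \<one> "[(q, 0)]" "[(q, 0)]" "[(p, 0)]"] by simp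
    then show False using mon_mem[OF m] that(1) by (simp add: endpoint_def)
  qed
  have filter: "poset_filter Q leq F"
    unfolding poset_filter_def
  proof (intro conjI ballI impI)
    show "F \<subseteq> Q" by (auto simp: F_def)
    show "F \<noteq> {}"
    proof
      assume "F = {}"
      \<comment> \<open>With \<open>F\<close> empty all monomials lie in \<open>I\<close>, hence so
        does their span, which contradicts properness.\<close>
      then have "monomials \<subseteq> ideal_monos I" using mon_mem by (auto simp: ideal_monos_def)
      then have "carrier W \<subseteq> I" using ideal_eq_span[OF ideal] span_mono by auto
      then show False using proper ideal_span[OF ideal] by auto
    qed
    show "\<exists>r\<in>F. leq r p \<and> leq r q" if "p \<in> F" "q \<in> F" for p q
      using prime_ideal_directed[OF I, of p q] that by (auto simp: F_def)
  qed (rule up)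
  note iff = mon_filter_ideal_iff[OF filter]
  have "ideal_monos I = ideal_monos (filter_ideal F)"
    using mon_mem iff[where k = "\<one>"] by (auto simp: ideal_monos_def)
  then have "I = filter_ideal F"
    using ideal_eq_span[OF ideal] ideal_eq_span[OF filter_ideal_ideal, of F] by simp
  with filter show ?thesis by blast
qed

text \<open>A filter can be read off from the vertex idempotents outside its ideal; conversely, a
  larger filter imposes more vanishing conditions.\<close>

lemma filter_ideal_subset_iff:
  assumes F: "poset_filter Q leq F" and G: "poset_filter Q leq G"
  shows "filter_ideal F \<subseteq> filter_ideal G \<longleftrightarrow> G \<subseteq> F"
proof
  assume sub: "filter_ideal F \<subseteq> filter_ideal G"
  have "idem q \<in> filter_ideal H \<longleftrightarrow> q \<notin> H" if "poset_filter Q leq H" "q \<in> Q" for q H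
    using mon_filter_ideal_iff[OF that(1) single_monomial[OF that(2), of 0], where k = "\<one>"]
    by (simp add: idem_def endpoint_def)
  with sub F G filterD(1)[OF G] show "G \<subseteq> F" by blast
qed (auto simp: filter_ideal_def)

subsection \<open>Matrix entries\<close>

definition unit_vec :: "'p word \<Rightarrow> 'p word \<Rightarrow> 'k" where
  "unit_vec y x = (if x = y then \<one> else \<zero>)"

text \<open>Column \<open>y\<close> is the image of a basis vector. Vectors may have infinite
  support, so linearity alone does not make an operator determined by its entries.\<close>

definition matrix :: "(('p word \<Rightarrow> 'k) \<Rightarrow> 'p word \<Rightarrow> 'k) \<Rightarrow> ('k, 'p) elt" where
  "matrix T = (\<lambda>(x, y). T (unit_vec y) x)"

lemma unit_vec_vecs [simp]: "unit_vec y \<in> vecs"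
  by (rule vecsI) (simp add: unit_vec_def)

lemma mon_unit_vec:
  assumes "k \<in> carrier K"
  shows "mon k (u, v) (unit_vec y) =
    (if prefix v y then (\<lambda>x. k \<otimes> unit_vec (u @ drop (length v) y) x) else (\<lambda>x. \<zero>))"
  using assms by (auto simp: fun_eq_iff mon_def unit_vec_def prefix_def)

text \<open>The operators all of whose matrix entries vanish form an ideal that contains no monomial.\<close>

lemma matrix_zero_imp_zero:
  assumes T: "T \<in> span monomials" and ent: "\<And>y x. T (unit_vec y) x = \<zero>"
  shows "T = (\<lambda>f x. \<zero>)"
proof -
  define J where "J = {T \<in> span monomials. \<forall>y. T (unit_vec y) = (\<lambda>x. \<zero>)}"
  have J: "two_sided_ideal J W"
    unfolding two_sided_ideal_def
  proof (intro conjI W.subspace_additive_subgroup ballI)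
    fix D U assume D: "D \<in> J" and U: "U \<in> carrier W"
    show "U \<otimes>\<^bsub>W\<^esub> D \<in> J"
      using D U by (auto simp: J_def span_mult span_apply_zero)
    \<comment> \<open>\<open>U\<close> sends a unit vector to a finite combination of unit vectors,
      and \<open>D\<close> vanishes on each of these.\<close>
    have "D (U (unit_vec y)) = (\<lambda>x. \<zero>)" for y
      using U unfolding W_simps
    proof (induction rule: span.induct)
      case zero
      then show ?case using D by (auto simp: J_def span_apply_zero)
    next
      case (add k m U)
      obtain u v where m: "m = (u, v)" by fastforce
      have "D (mon k m (unit_vec y)) = (\<lambda>x. \<zero>)"
        using D add.hyps by (auto simp: J_def mon_unit_vec m span_apply_smult span_apply_zero)
      moreover have "D (\<lambda>x. mon k m (unit_vec y) x \<oplus> U (unit_vec y) x) =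
          (\<lambda>x. D (mon k m (unit_vec y)) x \<oplus> D (U (unit_vec y)) x)"
        using D add.hyps by (intro span_apply_add[of D monomials]) (auto simp: J_def)
      ultimately show ?case using add.IH by simp
    qed
    then show "D \<otimes>\<^bsub>W\<^esub> U \<in> J" using D U by (auto simp: J_def span_mult)
  qed (auto simp: J_def span.zero span_add span_smult)
  have "mon \<one> (u, v) \<notin> J" for u v
  proof
    assume "mon \<one> (u, v) \<in> J"
    \<comment> \<open>The entry in row \<open>u\<close> and column \<open>v\<close> is the
      coefficient of the monomial.\<close>
    then have "mon \<one> (u, v) (unit_vec v) u = \<zero>" by (simp add: J_def)
    then show False by (simp add: mon_def unit_vec_def)
  qed
  then have "ideal_monos J = {}" by (auto simp: ideal_monos_def)
  moreover have "T \<in> J" using T ent by (auto simp: J_def fun_eq_iff)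
  ultimately have "T \<in> span {}" using ideal_eq_span[OF J] by simp
  then show ?thesis by cases auto
qed

lemma inj_on_matrix: "inj_on matrix (carrier W)"
proof (rule inj_onI)
  fix T U assume TU: "T \<in> carrier W" "U \<in> carrier W" "matrix T = matrix U"
  have minus: "a \<oplus> \<ominus> \<one> \<otimes> b = \<zero> \<longleftrightarrow> a = b" if "a \<in> carrier K" "b \<in> carrier K" for a b
    using that r_right_minus_eq[of a b] by (simp add: l_minus minus_eq)
  let ?D = "\<lambda>f x. T f x \<oplus> \<ominus> \<one> \<otimes> U f x"
  have "?D \<in> span monomials" using TU by (simp add: span_add span_smult)
  moreover have "?D (unit_vec y) x = \<zero>" for y x
    using fun_cong[OF TU(3), of "(x, y)"] TU(1,2) by (simp add: minus matrix_def)
  ultimately have "?D = (\<lambda>f x. \<zero>)" by (rule matrix_zero_imp_zero)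
  then have "T f x \<oplus> \<ominus> \<one> \<otimes> U f x = \<zero>" for f x by (simp add: fun_eq_iff)
  then show "T = U" using TU(1,2) by (simp add: minus fun_eq_iff)
qed

lemma algebra_transport_matrix: "algebra_transport K W matrix"
  by (intro algebra_transport.intro algebra_transport_axioms.intro assoc_algebra_W inj_on_matrix)

end

section \<open>The order isomorphism between the prime spectrum and \<open>P\<close>\<close>

theorem corollary28:
  fixes P :: "('p, 'q) gorder_scheme" and K :: "('k, 'r) ring_scheme"
  assumes "partial_order P" and "carrier P \<noteq> {}"
    and "cond_GLB P" and "cond_DC P" and "cond_DD P"
    and "field K"
  shows "\<exists>A :: ('k, ('k, 'p) elt) module.
           assoc_algebra K A \<and> order_isomorphic (Spec A) P"
proof -
  let ?Q = "irreducibles P"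
  interpret P: partial_order P by fact
  interpret W: word_algebra K ?Q "le P"
    by (intro word_algebra.intro word_algebra_axioms.intro assms(6))
      (auto simp: irreducibles_def intro: P.le_trans)
  interpret M: algebra_transport K W.W W.matrix by (rule W.algebra_transport_matrix)
  note poset = assms(1,3,4,5)
  \<comment> \<open>Passing from \<open>p\<close> to its filter reverses the order, and so does
    passing from a filter to its ideal; the composite preserves it.\<close>
  define g where "g p = W.matrix ` W.filter_ideal (irreducibles_above P p)" for p
  have filter: "poset_filter ?Q (le P) (irreducibles_above P p)" if "p \<in> carrier P" for p
    using poset_filter_irreducibles_above[OF poset that] .
  have g_le: "g p \<subseteq> g q \<longleftrightarrow> p \<sqsubseteq>\<^bsub>P\<^esub> q" if pq: "p \<in> carrier P" "q \<in> carrier P" for p q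
  proof -
    have sub: "W.filter_ideal F \<subseteq> carrier W.W" for F by (auto simp: W.filter_ideal_def)
    have "g p \<subseteq> g q \<longleftrightarrow> W.filter_ideal (irreducibles_above P p) \<subseteq> W.filter_ideal (irreducibles_above P q)"
      using M.mem_image_iff[OF sub] sub unfolding g_def by blast
    also have "\<dots> \<longleftrightarrow> p \<sqsubseteq>\<^bsub>P\<^esub> q"
      using pq by (simp add: W.filter_ideal_subset_iff filter irreducibles_above_subset_iff[OF poset])
    finally show ?thesis .
  qed
  have "g ` carrier P = carrier (Spec M.A)"
  proof -
    have "carrier (Spec W.W) = (\<lambda>p. W.filter_ideal (irreducibles_above P p)) ` carrier P"
      using W.prime_filter_ideal filter W.prime_ideal_eq_filter_ideal
        filter_eq_irreducibles_above[OF poset] by (fastforce simp: Spec_def)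
    then show ?thesis by (simp add: M.carrier_Spec_transported g_def image_image)
  qed
  moreover have "inj_on g (carrier P)"
    using g_le by (intro inj_onI P.le_antisym) (metis order_refl)+
  ultimately have bij: "bij_betw g (carrier P) (carrier (Spec M.A))" by (simp add: bij_betw_def)
  \<comment> \<open>The isomorphism is wanted from the spectrum to \<open>P\<close>, opposite to
    \<open>g\<close>.\<close>
  let ?h = "the_inv_into (carrier P) g"
  have "?h I \<in> carrier P" "g (?h I) = I" if "I \<in> carrier (Spec M.A)" for I
    using that bij by (auto simp: bij_betw_def the_inv_into_into f_the_inv_into_f)
  then have "?h I \<sqsubseteq>\<^bsub>P\<^esub> ?h J \<longleftrightarrow> I \<subseteq> J" if "I \<in> carrier (Spec M.A)" "J \<in> carrier (Spec M.A)" for I J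
    using that g_le by metis
  moreover have "weak_partial_order (Spec M.A)"
    by unfold_locales (auto simp: Spec_def)
  ultimately have "order_emb (Spec M.A) P ?h"
    using P.weak_partial_order_axioms by (simp add: order_emb_def Spec_def)
  then have "order_isomorphic (Spec M.A) P"
    using bij_betw_the_inv_into[OF bij] by (auto simp: order_isomorphic_def)
  then show ?thesis using M.assoc_algebra_transported by blast
qed

end
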